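(* The indexing algorithm described in the context (selection, derivation, generalization, expansion and addition operations, repeated until every concept has a key) is correct. That is, for every concept hierarchy $H$ the concept keys $\underline{X}_B$ and node keys $X_K$ it computes satisfy: 1. Every concept is assigned a key, and for any two distinct concepts $B_1, B_2$ one has $\mathrm{inst}(\underline{X}_{B_1}) \cap \mathrm{inst}(\underline{X}_{B_2}) = \emptyset$. 2. For every concept $B$, with concept key $\underline{X}_B$ of length $m$, every node $K$ with concept $B$, reached from the root via the path $K_1 \rightarrow \dots \rightarrow K_n \rightarrow K$, is assigned a node key $X_K$ such that: (a) $X_K$ is an instance of $\underline{X}_B$; (b) either $K$ is the root of $H$, or there exists $i$ with $1 \le i \le m$ such that the parent node $K_n$ of $K$ has node key $X_K[0,i]$ (i.e. $X_{K_n}$ is an initial key of $X_K$); (c) for every $j$ with $1 \le j \le m$, $X_K[0,j]$ is not the node key of any node outside the set $\{K_1,\dots,K_n,K\}$.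
   Context: Concept hierarchy: a finite rooted tree in which every node is labelled by a concept (the same concept may label several nodes), such that (i) no node has two distinct child nodes with the same concept, and (ii) the dependency graph is free of cycles. The dependency graph has the occurring concepts as vertices and an edge from $A$ to $B$ whenever some node with concept $A$ is a child of some node with concept $B$. A path $K_1\to\dots\to K_n$ in the hierarchy is a sequence of nodes with each $K_{i+1}$ a child of $K_i$. Keys: a key $X=[a_1,\dots,a_m]$ is a finite list whose entries are constants (natural numbers) or the variable symbol $x$; different occurrences of $x$ are independent. Its length is $m$, its $i$-th entry is written $X[i]$, and for $1\le j\le m$ the initial key $X[0,j]$ is $[a_1,\dots,a_j]$. A key $Y$ is an instance of a key $X$ if it has the same length and is obtained from $X$ by substituting constants for some (not necessarily all) occurrences of $x$, i.e. $Y[i]=X[i]$ whenever $X[i]\neq x$. $\mathrm{inst}(X)$ is the set of all instances of $X$. Generalization: for keys $X_1,\dots,X_m$, the generalized key $G$ has the length of the longest $X_j$; $G[i]=n$ if $X_j[i]=n\in\mathbb{N}$ for all $X_j$ of length $\ge i$, and $G[i]=x$ otherwise. Expansion: the expansion of a key $X_1$ of length $m$ towards a key $X_2$ of length $n\ge m$ is the key of length $n$ with $i$-th entry $X_1[i]$ for $i\le m$ and $X_2[i]$ for $m<i\le n$. For a concept $B$, $\mathrm{parents}(B)$ is the set of all nodes that have a child node with concept $B$. Indexing algorithm. Input: a concept hierarchy $H$, with a counter initialized to $0$ in each node. Output: a concept key $\underline{X}_B$ for every concept $B$ and a node key $X_K$ for every node $K$. Initialization: the root node and its concept get the key $[0]$.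 Repeat the following until every concept has a key: - OP I (selection): choose a concept $B$ (without a key) such that all elements of $\mathrm{parents}(B)$ already have a node key. - OP II (derivation): for each $K\in\mathrm{parents}(B)$, generate a key, for the child of $K$ with concept $B$, by appending the current counter of $K$ to $X_K$; then raise the counter of $K$ by 1. - OP III (generalization): generalize all keys generated in OP II. If the generalized key has instances in common with an already created concept key, append further numbers to it until this is no longer the case. The result is the concept key $\underline{X}_B$. - OP IV (expansion): expand every key generated in OP II towards $\underline{X}_B$; the results are the node keys. - OP V (addition): assign these node keys to the respective nodes of $H$ with concept $B$. *)

theory Defs
  imports Main
begin

record ('n, 'c) hierarchy =
  nodes :: "'n set"
  root_node :: 'n
  child_rel :: "('n \<times> 'n) set"  \<comment> \<open>\<open>(K, L)\<close> means that \<open>L\<close> is a child of \<open>K\<close>\<close>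
  concept_of :: "'n \<Rightarrow> 'c"

definition dependency :: "('n, 'c) hierarchy \<Rightarrow> ('c \<times> 'c) set" where
  "dependency H = {(concept_of H L, concept_of H K) | K L. (K, L) \<in> child_rel H}"

locale concept_hierarchy =
  fixes H :: "('n, 'c) hierarchy"
  assumes finite_nodes: "finite (nodes H)"
    and root_in_nodes: "root_node H \<in> nodes H"
    and child_rel_nodes: "child_rel H \<subseteq> nodes H \<times> nodes H"
    and root_no_parent: "(K, root_node H) \<notin> child_rel H"
    and unique_parent: "(K, L) \<in> child_rel H \<Longrightarrow> (K', L) \<in> child_rel H \<Longrightarrow> K = K'"
    and reachable: "K \<in> nodes H \<Longrightarrow> (root_node H, K) \<in> (child_rel H)\<^sup>*"
    and distinct_children:
      "(K, L) \<in> child_rel H \<Longrightarrow> (K, L') \<in> child_rel H \<Longrightarrow>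
        concept_of H L = concept_of H L' \<Longrightarrow> L = L'"
    and acyclic_dependency: "acyclic (dependency H)"

definition concepts :: "('n, 'c) hierarchy \<Rightarrow> 'c set" where
  "concepts H = concept_of H ` nodes H"

definition parents :: "('n, 'c) hierarchy \<Rightarrow> 'c \<Rightarrow> 'n set" where
  "parents H B = {K. \<exists>L. (K, L) \<in> child_rel H \<and> concept_of H L = B}"

definition parent :: "('n, 'c) hierarchy \<Rightarrow> 'n \<Rightarrow> 'n" where
  "parent H L = (THE K. (K, L) \<in> child_rel H)"

definition is_path :: "('n, 'c) hierarchy \<Rightarrow> 'n list \<Rightarrow> bool" where
  "is_path H ps \<longleftrightarrow>
    ps \<noteq> [] \<and> set ps \<subseteq> nodes H \<and> successively (\<lambda>K L. (K, L) \<in> child_rel H) ps"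


text \<open>Positions in keys are counted from 0, so the entry \<open>X[i]\<close> is \<open>X ! (i - 1)\<close>;
  the initial key \<open>X[0,j]\<close> is \<open>take j X\<close>.\<close>

datatype entry = Const nat | Var

type_synonym key = "entry list"

definition inst :: "key \<Rightarrow> key set" where
  "inst X = {Y. length Y = length X \<and> (\<forall>i < length X. X ! i \<noteq> Var \<longrightarrow> Y ! i = X ! i)}"

definition column :: "key set \<Rightarrow> nat \<Rightarrow> entry set" where
  "column S i = {Y ! i | Y. Y \<in> S \<and> i < length Y}"

definition generalize :: "key set \<Rightarrow> key" where
  "generalize S =
    map (\<lambda>i. if \<exists>n. column S i = {Const n} then the_elem (column S i) else Var)
      [0..<Max (length ` S)]"

definition expand :: "key \<Rightarrow> key \<Rightarrow> key" where
  "expand X1 X2 = X1 @ drop (length X1) X2"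

definition clash :: "key set \<Rightarrow> key \<Rightarrow> bool" where
  "clash T X \<longleftrightarrow> (\<exists>Y\<in>T. inst X \<inter> inst Y \<noteq> {})"


text \<open>The algorithm is nondeterministic (choice of the next concept, choice of the appended
  numbers), hence a transition system. While a concept \<open>B\<close> is being processed, \<open>pending\<close>
  holds \<open>(B, D, X)\<close>, where \<open>D\<close> maps each node with concept \<open>B\<close> to the key derived for it
  and \<open>X\<close> is the current candidate for the concept key of \<open>B\<close>.\<close>

record ('n, 'c) index_state =
  counter :: "'n \<Rightarrow> nat"
  concept_key :: "'c \<rightharpoonup> key"
  node_key :: "'n \<rightharpoonup> key"
  pending :: "('c \<times> ('n \<rightharpoonup> key) \<times> key) option"

definition init_state :: "('n, 'c) hierarchy \<Rightarrow> ('n, 'c) index_state" where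
  "init_state H =
    \<lparr>counter = (\<lambda>_. 0),
     concept_key = [concept_of H (root_node H) \<mapsto> [Const 0]],
     node_key = [root_node H \<mapsto> [Const 0]],
     pending = None\<rparr>"

definition derived_keys ::
    "('n, 'c) hierarchy \<Rightarrow> ('n, 'c) index_state \<Rightarrow> 'c \<Rightarrow> ('n \<rightharpoonup> key)" where
  "derived_keys H s B =
    (\<lambda>L. if (\<exists>K. (K, L) \<in> child_rel H) \<and> concept_of H L = B
         then Some (the (node_key s (parent H L)) @ [Const (counter s (parent H L))])
         else None)"

inductive index_step ::
    "('n, 'c) hierarchy \<Rightarrow> ('n, 'c) index_state \<Rightarrow> ('n, 'c) index_state \<Rightarrow> bool"
  for H where
  derivation:
    "index_step H s
      (s\<lparr>counter := (\<lambda>K. if K \<in> parents H B then counter s K + 1 else counter s K),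
         pending := Some (B, D, generalize (ran D))\<rparr>)"
    if "pending s = None" "B \<in> concepts H" "concept_key s B = None"
      "\<forall>K \<in> parents H B. node_key s K \<noteq> None" "D = derived_keys H s B"
| extension:
    "index_step H s (s\<lparr>pending := Some (B, D, X @ [Const n])\<rparr>)"
    if "pending s = Some (B, D, X)" "clash (ran (concept_key s)) X"
| assignment:
    "index_step H s
      (s\<lparr>concept_key := (concept_key s)(B \<mapsto> X),
         node_key := node_key s ++ (\<lambda>L. map_option (\<lambda>Y. expand Y X) (D L)),
         pending := None\<rparr>)"
    if "pending s = Some (B, D, X)" "\<not> clash (ran (concept_key s)) X"

definition final_state :: "('n, 'c) hierarchy \<Rightarrow> ('n, 'c) index_state \<Rightarrow> bool" where
  "final_state H s \<longleftrightarrow> (index_step H)\<^sup>*\<^sup>* (init_state H) s \<and> (\<nexists>s'. index_step H s s')"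

end

theory Submission
  imports Defs "HOL-Library.Sublist"
begin

text \<open>Every node key extends the key of its parent by a counter value that no other child of that
  parent ever receives. Hence the prefix order on node keys is the ancestor order of the tree, which
  gives (b) and (c). The algorithm never gets stuck because the dependency graph is acyclic, and
  appending numbers terminates because a clash requires two keys of the same length.\<close>

section \<open>Instances, generalization and expansion of keys\<close>

lemma in_inst_self: "X \<in> inst X"
  by (simp add: inst_def)

lemma length_inst: "Y \<in> inst X \<Longrightarrow> length Y = length X"
  by (simp add: inst_def)

text \<open>A constant of the generalized key at position \<open>i\<close> comes from a singleton
  column, and \<open>Y ! i\<close> lies in that column. Keys in \<open>S\<close> may differ in
  length, hence the comparison with an initial key only.\<close>

lemma in_inst_generalize:
  assumes "finite S" "Y \<in> S"
  shows "Y \<in> inst (take (length Y) (generalize S))"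
proof -
  have len: "length Y \<le> length (generalize S)"
    using assms by (simp add: generalize_def)
  have "Y ! i = generalize S ! i" if i: "i < length Y" "generalize S ! i \<noteq> Var" for i
  proof -
    have "Y ! i \<in> column S i"
      using assms(2) i(1) by (auto simp: column_def)
    moreover have "i < Max (length ` S)"
      using len i(1) by (simp add: generalize_def)
    ultimately show ?thesis
      using i(2) by (auto simp: generalize_def split: if_splits)
  qed
  then show ?thesis
    using len by (simp add: inst_def)
qed

lemma in_inst_take_append:
  assumes "Y \<in> inst (take (length Y) X)"
  shows "Y \<in> inst (take (length Y) (X @ Z))"
proof -
  have "length Y \<le> length X"
    using length_inst[OF assms] by simp
  then show ?thesis
    using assms by simp
qed

text \<open>Past the end of \<open>Y\<close> the expansion copies \<open>X\<close> literally; the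
  assumption covers the rest.\<close>

lemma expand_in_inst:
  assumes "Y \<in> inst (take (length Y) X)"
  shows "expand Y X \<in> inst X"
proof -
  have "length Y \<le> length X"
    using length_inst[OF assms] by simp
  then show ?thesis
    using assms by (auto simp: inst_def expand_def nth_append)
qed

text \<open>An instance has the length of its key, so keys with a common instance are equally long.
  This bounds how often a candidate can be extended.\<close>

lemma clash_length:
  assumes "clash T X"
  shows "\<exists>Y\<in>T. length Y = length X"
  using assms by (fastforce simp: clash_def inst_def)

section \<open>Nodes in play and the termination measure\<close>

text \<open>A pending derived key counts already: the counter of the parent is raised at derivation,
  whereas \<open>node_key\<close> changes only at assignment.\<close>

definition active :: "('n, 'c) index_state \<Rightarrow> 'n set" where
  "active s = dom (node_key s) \<union> (case pending s of None \<Rightarrow> {} | Some (B, D, X) \<Rightarrow> dom D)"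

definition max_length :: "('n, 'c) index_state \<Rightarrow> nat" where
  "max_length s = Max (length ` ran (concept_key s))"

text \<open>Lexicographic measure: only an assignment changes the set of unkeyed concepts.\<close>

definition unfinished :: "('n, 'c) hierarchy \<Rightarrow> ('n, 'c) index_state \<Rightarrow> nat \<times> nat \<times> nat" where
  "unfinished H s =
    (card (concepts H - dom (concept_key s)),
     case pending s of
       None \<Rightarrow> (1, 0)
     | Some (B, D, X) \<Rightarrow> (0, Suc (max_length s) - length X))"

context concept_hierarchy
begin

section \<open>The tree and its dependency graph\<close>

lemma parent_eq: "(P, L) \<in> child_rel H \<Longrightarrow> parent H L = P"
  unfolding parent_def using unique_parent by blast

lemma child_nodes: "(P, L) \<in> child_rel H \<Longrightarrow> P \<in> nodes H \<and> L \<in> nodes H"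
  using child_rel_nodes by blast

lemma ex_parent:
  assumes "L \<in> nodes H" "L \<noteq> root_node H"
  shows "\<exists>P. (P, L) \<in> child_rel H"
  using reachable[OF assms(1)] assms(2) by (auto elim: rtranclE)

lemma finite_concepts: "finite (concepts H)"
  by (simp add: concepts_def finite_nodes)

text \<open>Edges of \<open>dependency\<close> point from the child's concept to the parent's, so a
  descent in the tree is traversed backwards in the graph.\<close>

lemma descendant_dependency:
  "(K, L) \<in> (child_rel H)\<^sup>+ \<Longrightarrow> (concept_of H L, concept_of H K) \<in> (dependency H)\<^sup>+"
proof (induction rule: trancl_induct)
  case (base L)
  then show ?case
    by (auto simp: dependency_def)
next
  case (step L M)
  then have "(concept_of H M, concept_of H L) \<in> dependency H"
    by (auto simp: dependency_def)
  then show ?case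
    using step.IH by (rule trancl_into_trancl2)
qed

text \<open>Any other node with this concept would be a proper descendant of the root and close a
  cycle in \<open>dependency\<close>. Initialization relies on this: it keys a single node for that
  concept.\<close>

lemma root_concept_unique:
  assumes "L \<in> nodes H" "concept_of H L = concept_of H (root_node H)"
  shows "L = root_node H"
proof (rule ccontr)
  assume "L \<noteq> root_node H"
  then have "(root_node H, L) \<in> (child_rel H)\<^sup>+"
    using reachable[OF assms(1)] by (metis rtranclD)
  then have "(concept_of H L, concept_of H L) \<in> (dependency H)\<^sup>+"
    using descendant_dependency assms(2) by metis
  then show False
    using acyclic_dependency by (auto simp: acyclic_def)
qed

text \<open>With the converse relation, a minimal element of a set of concepts is one whose parent
  nodes all have concepts outside the set.\<close>

lemma wf_dependency: "wf ((dependency H)\<inverse>)"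
proof -
  have "dependency H \<subseteq> concepts H \<times> concepts H"
    using child_nodes by (fastforce simp: dependency_def concepts_def)
  then have "finite (dependency H)"
    using finite_concepts finite_subset by blast
  then show ?thesis
    using acyclic_dependency by (rule finite_acyclic_wf_converse)
qed

section \<open>Ancestors, paths and prefixes of keys\<close>

lemma path_last_child:
  assumes "is_path H (Ks @ [K])" "Ks \<noteq> []"
  shows "(last Ks, K) \<in> child_rel H" "is_path H Ks"
  using assms by (auto simp: is_path_def successively_append_iff)

text \<open>Parents are unique, so climbing from \<open>K\<close> follows the path backwards up to
  the root, which has no parent.\<close>

lemma ancestor_on_path:
  assumes "is_path H (Ks @ [K])" "hd (Ks @ [K]) = root_node H" "(A, K) \<in> (child_rel H)\<^sup>*"
  shows "A \<in> set (Ks @ [K])"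
  using assms
proof (induction Ks arbitrary: K rule: rev_induct)
  case Nil
  then show ?case
    using root_no_parent by (auto elim: rtranclE)
next
  case (snoc P Ks)
  have P: "(P, K) \<in> child_rel H" "is_path H (Ks @ [P])"
    using path_last_child[OF snoc.prems(1)] by auto
  have "hd (Ks @ [P]) = root_node H"
    using snoc.prems(2) by (cases Ks) auto
  show ?case
  proof (cases "A = K")
    case False
    then obtain P' where "(A, P') \<in> (child_rel H)\<^sup>*" "(P', K) \<in> child_rel H"
      using snoc.prems(3) by (auto elim: rtranclE)
    then have "(A, P) \<in> (child_rel H)\<^sup>*"
      using unique_parent P(1) by blast
    then show ?thesis
      using snoc.IH[OF P(2)] \<open>hd (Ks @ [P]) = root_node H\<close> by auto
  qed simp
qed

text \<open>Induction along the way from the root to \<open>L\<close>. Once the parent of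
  \<open>L\<close> is an ancestor of \<open>K\<close>, the entry of \<open>key K\<close> right after
  the parent's key tells which child leads to \<open>K\<close>, because slots separate
  siblings.\<close>

lemma prefix_key_imp_ancestor:
  fixes key :: "'n \<Rightarrow> 'k list" and slot :: "'n \<Rightarrow> 'k"
  assumes key: "\<And>P L. (P, L) \<in> child_rel H \<Longrightarrow> \<exists>Z. key L = key P @ slot L # Z"
    and slot: "\<And>P L L'. (P, L) \<in> child_rel H \<Longrightarrow> (P, L') \<in> child_rel H \<Longrightarrow>
      slot L = slot L' \<Longrightarrow> L = L'"
    and nodes: "K \<in> nodes H" "L \<in> nodes H"
    and prefix: "prefix (key L) (key K)"
  shows "(L, K) \<in> (child_rel H)\<^sup>*"
proof -
  have mono: "prefix (key A) (key M)" if "(A, M) \<in> (child_rel H)\<^sup>*" for A M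
    using that
  proof induction
    case (step M N)
    then show ?case
      using key[OF step.hyps(2)] by (auto intro: prefix_order.trans)
  qed simp
  have "(root_node H, L) \<in> (child_rel H)\<^sup>*"
    by (rule reachable[OF nodes(2)])
  then show ?thesis
    using prefix
  proof induction
    case base
    show ?case
      by (rule reachable[OF nodes(1)])
  next
    case (step P L)
    obtain Z where Z: "key L = key P @ slot L # Z"
      using key[OF step.hyps(2)] by blast
    have PK: "(P, K) \<in> (child_rel H)\<^sup>*"
      using step.IH step.prems Z append_prefixD by metis
    \<comment> \<open>\<open>key L\<close> is strictly longer than \<open>key P\<close>, so it
      cannot be a prefix of it.\<close>
    have "P \<noteq> K"
      using step.prems Z by (auto dest: prefix_length_le)
    then obtain L' where L': "(P, L') \<in> child_rel H" "(L', K) \<in> (child_rel H)\<^sup>*"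
      using PK by (auto elim: converse_rtranclE)
    obtain Z' where Z': "key L' = key P @ slot L' # Z'"
      using key[OF L'(1)] by blast
    \<comment> \<open>Both slots are the entry of \<open>key K\<close> at index
      \<open>length (key P)\<close>.\<close>
    have "slot L = slot L'"
      using step.prems mono[OF L'(2)] Z Z' by (auto simp: prefix_def)
    then show ?case
      using slot step.hyps(2) L' by blast
  qed
qed

section \<open>Invariants of a run\<close>

text \<open>The slot of a node is the counter value that its parent hands out to it.\<close>

definition slots_inv :: "('n \<Rightarrow> nat) \<Rightarrow> ('n, 'c) index_state \<Rightarrow> bool" where
  "slots_inv slot s \<longleftrightarrow>
    (\<forall>P L. (P, L) \<in> child_rel H \<and> L \<in> active s \<longrightarrow> slot L < counter s P) \<and>
    (\<forall>P L L'. (P, L) \<in> child_rel H \<and> (P, L') \<in> child_rel H \<and>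
      L \<in> active s \<and> L' \<in> active s \<and> slot L = slot L' \<longrightarrow> L = L')"

lemma slot_less_counter:
  "slots_inv slot s \<Longrightarrow> (P, L) \<in> child_rel H \<Longrightarrow> L \<in> active s \<Longrightarrow> slot L < counter s P"
  unfolding slots_inv_def by blast

lemma slot_eq_siblings:
  "slots_inv slot s \<Longrightarrow> (P, L) \<in> child_rel H \<Longrightarrow> (P, L') \<in> child_rel H \<Longrightarrow>
    L \<in> active s \<Longrightarrow> L' \<in> active s \<Longrightarrow> slot L = slot L' \<Longrightarrow> L = L'"
  unfolding slots_inv_def by blast

text \<open>The tail \<open>Z\<close> leaves room for what expansion adds after the slot. Nonempty
  node keys secure the bound \<open>1 \<le> i\<close> in (b).\<close>

definition keys_inv :: "('n \<Rightarrow> nat) \<Rightarrow> ('n, 'c) index_state \<Rightarrow> bool" where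
  "keys_inv slot s \<longleftrightarrow>
    dom (concept_key s) \<subseteq> concepts H \<and>
    concept_of H (root_node H) \<in> dom (concept_key s) \<and>
    dom (node_key s) = {L \<in> nodes H. concept_of H L \<in> dom (concept_key s)} \<and>
    (\<forall>B1 B2 X1 X2. concept_key s B1 = Some X1 \<and> concept_key s B2 = Some X2 \<and> B1 \<noteq> B2 \<longrightarrow>
      inst X1 \<inter> inst X2 = {}) \<and>
    (\<forall>L X. node_key s L = Some X \<longrightarrow> X \<noteq> [] \<and> X \<in> inst (the (concept_key s (concept_of H L)))) \<and>
    (\<forall>P L X. (P, L) \<in> child_rel H \<and> node_key s L = Some X \<longrightarrow>
      (\<exists>Y Z. node_key s P = Some Y \<and> X = Y @ Const (slot L) # Z))"

text \<open>The candidate may be longer than a derived key, hence \<open>take\<close>. Derived keys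
  are not yet expanded, so they end with the slot.\<close>

definition pending_inv :: "('n \<Rightarrow> nat) \<Rightarrow> ('n, 'c) index_state \<Rightarrow> bool" where
  "pending_inv slot s \<longleftrightarrow> (\<forall>B D X. pending s = Some (B, D, X) \<longrightarrow>
    B \<in> concepts H \<and> concept_key s B = None \<and>
    dom D = {L \<in> nodes H. concept_of H L = B} \<and>
    (\<forall>L Y. D L = Some Y \<longrightarrow> Y \<in> inst (take (length Y) X)) \<and>
    (\<forall>P L Y. (P, L) \<in> child_rel H \<and> D L = Some Y \<longrightarrow>
      (\<exists>Y'. node_key s P = Some Y' \<and> Y = Y' @ [Const (slot L)])))"

text \<open>A state records current counters but not the values handed out before; the existential
  lets each derivation fix the slots of the nodes it treats.\<close>

definition state_inv :: "('n, 'c) index_state \<Rightarrow> bool" where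
  "state_inv s \<longleftrightarrow> (\<exists>slot. slots_inv slot s \<and> keys_inv slot s \<and> pending_inv slot s)"

section \<open>Preservation of the invariants\<close>

lemma state_inv_init: "state_inv (init_state H)"
proof -
  \<comment> \<open>The value 0 is arbitrary: the only active node is the root, which is no
    child.\<close>
  let ?s = "init_state H" and ?slot = "\<lambda>_. 0"
  have "slots_inv ?slot ?s"
    using root_no_parent by (auto simp: slots_inv_def active_def init_state_def)
  moreover have "keys_inv ?slot ?s"
    using root_no_parent root_in_nodes root_concept_unique
    by (auto simp: keys_inv_def init_state_def in_inst_self concepts_def split: if_splits)
  moreover have "pending_inv ?slot ?s"
    by (simp add: pending_inv_def init_state_def)
  ultimately show ?thesis
    unfolding state_inv_def by blast
qed

text \<open>The counter of a parent exceeds all slots in use among its children, and its value goes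
  to only one new child because siblings carry distinct concepts. One increment restores the
  bound.\<close>

lemma state_inv_derivation:
  assumes inv: "state_inv s"
    and none: "pending s = None"
    and B: "B \<in> concepts H" "concept_key s B = None"
    and keyed: "\<forall>K \<in> parents H B. node_key s K \<noteq> None"
    and D: "D = derived_keys H s B"
  shows "state_inv (s\<lparr>counter := (\<lambda>K. if K \<in> parents H B then counter s K + 1 else counter s K),
    pending := Some (B, D, generalize (ran D))\<rparr>)"
    (is "state_inv ?s")
proof -
  from inv obtain slot where slots: "slots_inv slot s" and keys: "keys_inv slot s"
    unfolding state_inv_def by blast
  \<comment> \<open>New slots are the counters before the increment. No node with concept
    \<open>B\<close> was active so far, so no slot in use is overwritten.\<close>
  define slot' where
    "slot' L = (if concept_of H L = B then counter s (parent H L) else slot L)" for L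
  have domD: "dom D = {L \<in> nodes H. concept_of H L = B}"
  proof -
    \<comment> \<open>The root's concept is already keyed, so it is not \<open>B\<close>; every node
      with concept \<open>B\<close> has a parent and gets a derived key.\<close>
    have "L \<noteq> root_node H" if "concept_of H L = B" for L
      using that keys B(2) by (auto simp: keys_inv_def)
    then show ?thesis
      using ex_parent child_nodes unfolding D derived_keys_def
      by (auto simp: dom_def split: if_splits)
  qed
  have old: "L \<in> active s \<and> slot' L = slot L" if "L \<in> active ?s" "concept_of H L \<noteq> B" for L
    using that none domD by (auto simp: active_def slot'_def)
  have old_lt: "slot' L < counter s P"
    if "(P, L) \<in> child_rel H" "L \<in> active ?s" "concept_of H L \<noteq> B" for P L
    using old[OF that(2,3)] slot_less_counter[OF slots that(1)] by simp
  have new: "slot' L = counter s P \<and> P \<in> parents H B"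
    if "(P, L) \<in> child_rel H" "concept_of H L = B" for P L
    using that parent_eq by (auto simp: slot'_def parents_def)
  have "slots_inv slot' ?s"
    unfolding slots_inv_def
  proof (intro conjI allI impI; elim conjE)
    fix P L
    assume L: "(P, L) \<in> child_rel H" "L \<in> active ?s"
    show "slot' L < counter ?s P"
      using old_lt[OF L] new[OF L(1)] by (cases "concept_of H L = B") auto
  next
    fix P L L'
    assume L: "(P, L) \<in> child_rel H" "(P, L') \<in> child_rel H"
      "L \<in> active ?s" "L' \<in> active ?s" "slot' L = slot' L'"
    \<comment> \<open>In the mixed cases one slot equals the old counter of \<open>P\<close> and the
      other lies strictly below it.\<close>
    consider "concept_of H L = B" "concept_of H L' = B"
      | "concept_of H L = B" "concept_of H L' \<noteq> B"
      | "concept_of H L \<noteq> B" "concept_of H L' = B"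
      | "concept_of H L \<noteq> B" "concept_of H L' \<noteq> B"
      by blast
    then show "L = L'"
    proof cases
      case 1
      then show ?thesis using distinct_children L by auto
    next
      case 2
      then show ?thesis using new[of P L] old_lt[of P L'] L by auto
    next
      case 3
      then show ?thesis using new[of P L'] old_lt[of P L] L by auto
    next
      case 4
      then show ?thesis
        using old[of L] old[of L'] L slot_eq_siblings[OF slots, of P L L'] by simp
    qed
  qed
  moreover have "keys_inv slot' ?s"
  proof -
    have "slot' L = slot L" if "L \<in> dom (node_key s)" for L
      using that keys B(2) by (auto simp: keys_inv_def slot'_def)
    then have "\<forall>P L X. (P, L) \<in> child_rel H \<and> node_key s L = Some X \<longrightarrow>
      (\<exists>Y Z. node_key s P = Some Y \<and> X = Y @ Const (slot' L) # Z)"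
      using keys unfolding keys_inv_def by (metis domI)
    then show ?thesis
      using keys unfolding keys_inv_def by simp
  qed
  moreover have "pending_inv slot' ?s"
  proof -
    have "finite (ran D)"
      using domD finite_nodes by (intro finite_ran) auto
    then have "Y \<in> inst (take (length Y) (generalize (ran D)))" if "D L = Some Y" for L Y
      using that by (intro in_inst_generalize ranI)
    moreover have "\<exists>Y'. node_key s P = Some Y' \<and> Y = Y' @ [Const (slot' L)]"
      if "(P, L) \<in> child_rel H" "D L = Some Y" for P L Y
    proof -
      have L: "concept_of H L = B" "Y = the (node_key s P) @ [Const (counter s P)]"
        using that parent_eq unfolding D derived_keys_def by (auto split: if_splits)
      then show ?thesis
        using new[OF that(1)] keyed by auto
    qed
    ultimately show ?thesis
      using B domD by (auto simp: pending_inv_def)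
  qed
  ultimately show ?thesis
    unfolding state_inv_def by blast
qed

text \<open>Appending at the end leaves the compared initial parts of the candidate unchanged, and
  \<open>D\<close> stays the same.\<close>

lemma state_inv_extension:
  assumes inv: "state_inv s" and pending: "pending s = Some (B, D, X)"
  shows "state_inv (s\<lparr>pending := Some (B, D, X @ [Const n])\<rparr>)" (is "state_inv ?s")
proof -
  from inv obtain slot where slots: "slots_inv slot s" and keys: "keys_inv slot s"
    and pend: "pending_inv slot s"
    unfolding state_inv_def by blast
  have "active ?s = active s"
    using pending by (simp add: active_def)
  then have "slots_inv slot ?s = slots_inv slot s"
    by (simp add: slots_inv_def)
  with slots have "slots_inv slot ?s"
    by blast
  moreover have "keys_inv slot ?s"
    using keys by (simp add: keys_inv_def)
  moreover have "pending_inv slot ?s"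
    using pend pending in_inst_take_append by (fastforce simp: pending_inv_def)
  ultimately show ?thesis
    unfolding state_inv_def by blast
qed

text \<open>The nodes in \<open>dom D\<close> move from pending to keyed, so the active nodes stay
  the same. Expansion adds entries only after the slot, and the absence of a clash is the
  disjointness required of the new concept key.\<close>

lemma state_inv_assignment:
  assumes inv: "state_inv s" and pending: "pending s = Some (B, D, X)"
    and no_clash: "\<not> clash (ran (concept_key s)) X"
  shows "state_inv (s\<lparr>concept_key := (concept_key s)(B \<mapsto> X),
    node_key := node_key s ++ (\<lambda>L. map_option (\<lambda>Y. expand Y X) (D L)), pending := None\<rparr>)"
    (is "state_inv ?s")
proof -
  from inv obtain slot where slots: "slots_inv slot s" and keys: "keys_inv slot s"
    and pend: "pending_inv slot s"
    unfolding state_inv_def by blast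
  have B: "B \<in> concepts H" "concept_key s B = None"
    and domD: "dom D = {L \<in> nodes H. concept_of H L = B}"
    using pend pending unfolding pending_inv_def by blast+
  have D: "Y \<in> inst (take (length Y) X)" if "D L = Some Y" for L Y
    using pend pending that unfolding pending_inv_def by blast
  have D_child: "\<exists>Y'. node_key s P = Some Y' \<and> Y = Y' @ [Const (slot L)]"
    if "(P, L) \<in> child_rel H" "D L = Some Y" for P L Y
    using pend pending that unfolding pending_inv_def by blast
  have disjoint: "dom D \<inter> dom (node_key s) = {}"
    using domD keys B(2) by (auto simp: keys_inv_def)
  have dom': "dom (node_key ?s) = dom (node_key s) \<union> dom D"
    by (auto simp: map_add_def dom_def split: option.splits)
  have old: "node_key ?s L = node_key s L" if "D L = None" for L
    using that by (simp add: map_add_def)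
  have new: "node_key ?s L = Some (expand Y X)" if "D L = Some Y" for L Y
    using that by (simp add: map_add_def)
  \<comment> \<open>\<open>++\<close> prefers its right argument; old keys survive because no keyed
    node has a derived key.\<close>
  have mono: "node_key ?s L = Some Y" if "node_key s L = Some Y" for L Y
    using that disjoint old[of L] by (metis disjoint_iff domI domIff)
  have "active ?s = active s"
    using dom' pending by (simp add: active_def)
  then have "slots_inv slot ?s = slots_inv slot s"
    by (simp add: slots_inv_def)
  with slots have "slots_inv slot ?s"
    by blast
  moreover have "keys_inv slot ?s"
    unfolding keys_inv_def
  proof (intro conjI allI impI; (elim conjE)?)
    show "dom (concept_key ?s) \<subseteq> concepts H"
      using keys B by (simp add: keys_inv_def)
    show "concept_of H (root_node H) \<in> dom (concept_key ?s)"
      using keys by (simp add: keys_inv_def)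
    show "dom (node_key ?s) = {L \<in> nodes H. concept_of H L \<in> dom (concept_key ?s)}"
      unfolding dom' domD using keys by (auto simp: keys_inv_def)
  next
    fix B1 B2 X1 X2
    assume "concept_key ?s B1 = Some X1" "concept_key ?s B2 = Some X2" "B1 \<noteq> B2"
    moreover have "inst X \<inter> inst Y = {}" if "concept_key s C = Some Y" for C Y
      using no_clash that by (auto simp: clash_def ran_def)
    moreover have "inst Y1 \<inter> inst Y2 = {}"
      if "concept_key s C1 = Some Y1" "concept_key s C2 = Some Y2" "C1 \<noteq> C2" for C1 C2 Y1 Y2
      using keys that unfolding keys_inv_def by metis
    ultimately show "inst X1 \<inter> inst X2 = {}"
      by (simp split: if_splits) blast
  next
    fix L Y
    assume L: "node_key ?s L = Some Y"
    show "Y \<in> inst (the (concept_key ?s (concept_of H L)))"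
    proof (cases "D L")
      case None
      then have Y: "node_key s L = Some Y"
        using L old by simp
      then have "L \<in> nodes H"
        using keys unfolding keys_inv_def by blast
      then have "concept_of H L \<noteq> B"
        using None domD by blast
      moreover have "Y \<in> inst (the (concept_key s (concept_of H L)))"
        using keys Y unfolding keys_inv_def by blast
      ultimately show ?thesis
        by simp
    next
      case (Some Y')
      then have "concept_of H L = B"
        using domD by blast
      then show ?thesis
        using L new[OF Some] expand_in_inst[OF D[OF Some]] by simp
    qed
    show "Y \<noteq> []"
    proof (cases "D L")
      case None
      then show ?thesis
        using L old[OF None] keys unfolding keys_inv_def by metis
    next
      case (Some Y')
      then have "L \<in> nodes H" "concept_of H L = B"
        using domD by blast+
      moreover from this have "L \<noteq> root_node H"
        using keys B(2) unfolding keys_inv_def by (metis domIff)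
      ultimately obtain P where "(P, L) \<in> child_rel H"
        using ex_parent by blast
      then show ?thesis
        using D_child[OF _ Some] L new[OF Some] by (auto simp: expand_def)
    qed
  next
    fix P L Y
    assume L: "(P, L) \<in> child_rel H" "node_key ?s L = Some Y"
    show "\<exists>Y' Z. node_key ?s P = Some Y' \<and> Y = Y' @ Const (slot L) # Z"
    proof (cases "D L")
      case None
      then have "node_key s L = Some Y"
        using L(2) old by simp
      then show ?thesis
        using L(1) keys mono unfolding keys_inv_def by blast
    next
      case (Some Y')
      then obtain Y'' where "node_key s P = Some Y''" "Y' = Y'' @ [Const (slot L)]"
        using D_child L(1) by blast
      then show ?thesis
        using mono L(2) new[OF Some] by (simp add: expand_def)
    qed
  qed
  moreover have "pending_inv slot ?s"
    by (simp add: pending_inv_def)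
  ultimately show ?thesis
    unfolding state_inv_def by blast
qed

lemma state_inv_step: "index_step H s s' \<Longrightarrow> state_inv s \<Longrightarrow> state_inv s'"
  by (induction rule: index_step.induct)
    (simp_all add: state_inv_derivation state_inv_extension state_inv_assignment)

lemma state_inv_reachable: "(index_step H)\<^sup>*\<^sup>* (init_state H) s \<Longrightarrow> state_inv s"
  by (induction rule: rtranclp_induct) (auto intro: state_inv_init state_inv_step)

section \<open>Termination\<close>

text \<open>Derivation lowers the second component from 1 to 0, extension lowers the third, and
  assignment removes \<open>B\<close> from the unkeyed concepts.\<close>

lemma step_decreases:
  assumes "index_step H s s'" "state_inv s"
  shows "(unfinished H s', unfinished H s) \<in> less_than <*lex*> less_than <*lex*> less_than"
  using assms
proof cases
  case (derivation B D)
  then show ?thesis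
    by (simp add: unfinished_def)
next
  case (extension B D X n)
  obtain Y where Y: "Y \<in> ran (concept_key s)" "length Y = length X"
    using clash_length extension(3) by blast
  have "dom (concept_key s) \<subseteq> concepts H"
    using assms(2) by (auto simp: state_inv_def keys_inv_def)
  then have "finite (ran (concept_key s))"
    using finite_concepts finite_subset by (blast intro: finite_ran)
  \<comment> \<open>With this bound \<open>Suc (max_length s) - length X\<close> is positive, so the
    truncated subtraction really drops when \<open>X\<close> grows.\<close>
  then have "length X \<le> max_length s"
    using Y unfolding max_length_def by (metis Max_ge finite_imageI imageI)
  then show ?thesis
    using extension by (simp add: unfinished_def max_length_def)
next
  case (assignment B D X)
  then have "B \<in> concepts H - dom (concept_key s)"
    using assms(2) by (auto simp: state_inv_def pending_inv_def)
  then have "card (concepts H - dom (concept_key s) - {B}) < card (concepts H - dom (concept_key s))"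
    using finite_concepts by (intro card_Diff1_less) auto
  moreover have "concepts H - dom (concept_key s') = concepts H - dom (concept_key s) - {B}"
    using assignment by auto
  ultimately show ?thesis
    by (simp add: unfinished_def)
qed

lemma no_infinite_run:
  "\<nexists>run. run 0 = init_state H \<and> (\<forall>t::nat. index_step H (run t) (run (Suc t)))"
proof
  assume "\<exists>run. run 0 = init_state H \<and> (\<forall>t::nat. index_step H (run t) (run (Suc t)))"
  then obtain run where run: "run 0 = init_state H" "\<And>t::nat. index_step H (run t) (run (Suc t))"
    by blast
  have "state_inv (run t)" for t
    by (induction t) (auto simp: run(1) intro: state_inv_init state_inv_step run(2))
  then have "(unfinished H (run (Suc t)), unfinished H (run t))
      \<in> less_than <*lex*> less_than <*lex*> less_than" for t
    using step_decreases run(2) by blast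
  moreover have "wf (less_than <*lex*> less_than <*lex*> less_than)"
    by (intro wf_lex_prod wf_less_than)
  ultimately show False
    unfolding wf_iff_no_infinite_down_chain
    by (elim notE, intro exI[of _ "\<lambda>t. unfinished H (run t)"] allI)
qed

section \<open>Correctness of final states\<close>

text \<open>Otherwise some unkeyed concept has only keyed concepts above it, its parent nodes are
  then keyed, and a derivation would be possible.\<close>

lemma final_concepts_keyed:
  assumes inv: "state_inv s" and final: "\<nexists>s'. index_step H s s'"
  shows "concepts H \<subseteq> dom (concept_key s)"
proof (rule ccontr)
  assume "\<not> concepts H \<subseteq> dom (concept_key s)"
  then obtain B0 where "B0 \<in> concepts H - dom (concept_key s)"
    by blast
  then obtain B where B: "B \<in> concepts H - dom (concept_key s)"
    and min: "\<And>A. (A, B) \<in> (dependency H)\<inverse> \<Longrightarrow> A \<notin> concepts H - dom (concept_key s)"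
    using wfE_min[OF wf_dependency] by metis
  have "node_key s K \<noteq> None" if parent: "K \<in> parents H B" for K
  proof -
    obtain L where L: "(K, L) \<in> child_rel H" "concept_of H L = B"
      using parent unfolding parents_def by blast
    then have "(B, concept_of H K) \<in> dependency H"
      by (auto simp: dependency_def)
    moreover have K: "K \<in> nodes H"
      using child_nodes L by blast
    ultimately have "concept_of H K \<in> dom (concept_key s)"
      using min by (auto simp: concepts_def)
    moreover have "dom (node_key s) = {L \<in> nodes H. concept_of H L \<in> dom (concept_key s)}"
      using inv unfolding state_inv_def keys_inv_def by blast
    ultimately have "K \<in> dom (node_key s)"
      using K by blast
    then show ?thesis
      by blast
  qed
  \<comment> \<open>A pending candidate always admits a step: extension if it clashes, assignment if
    not.\<close>
  moreover have "pending s = None"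
  proof (rule ccontr)
    assume "pending s \<noteq> None"
    then obtain C D X where pending: "pending s = Some (C, D, X)"
      by (metis option.exhaust prod_cases3)
    show False
      using final index_step.extension[OF pending] index_step.assignment[OF pending]
      by (cases "clash (ran (concept_key s)) X") blast+
  qed
  ultimately show False
    using index_step.derivation[of s B H] B final by blast
qed

lemma final_correct:
  assumes "final_state H s"
  shows "(\<forall>B \<in> concepts H. concept_key s B \<noteq> None) \<and>
      (\<forall>B1 \<in> concepts H. \<forall>B2 \<in> concepts H. B1 \<noteq> B2 \<longrightarrow>
        inst (the (concept_key s B1)) \<inter> inst (the (concept_key s B2)) = {}) \<and>
      (\<forall>B \<in> concepts H. \<forall>XB m K. concept_key s B = Some XB \<and> m = length XB \<and>
          K \<in> nodes H \<and> concept_of H K = B \<longrightarrow>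
        (\<exists>XK. node_key s K = Some XK \<and>
          XK \<in> inst XB \<and>
          (\<forall>Ks. is_path H (Ks @ [K]) \<and> hd (Ks @ [K]) = root_node H \<longrightarrow>
            (K = root_node H \<or> (\<exists>i \<in> {1..m}. node_key s (last Ks) = Some (take i XK))) \<and>
            (\<forall>j \<in> {1..m}. \<forall>L \<in> nodes H - set (Ks @ [K]).
              node_key s L \<noteq> Some (take j XK)))))"
proof (intro conjI)
  have inv: "state_inv s" and final: "\<nexists>s'. index_step H s s'"
    using assms state_inv_reachable by (auto simp: final_state_def)
  then obtain slot where slots: "slots_inv slot s" and keys: "keys_inv slot s"
    unfolding state_inv_def by blast
  have all: "concepts H \<subseteq> dom (concept_key s)"
    using final_concepts_keyed inv final by blast
  have dom_node: "dom (node_key s) = nodes H"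
    using keys all by (auto simp: keys_inv_def concepts_def)
  define key where "key = (\<lambda>L. the (node_key s L))"
  have node_key: "node_key s L = Some (key L)" if "L \<in> nodes H" for L
    using that dom_node unfolding key_def by (metis domD option.sel)
  have key_child: "\<exists>Z. key L = key P @ Const (slot L) # Z" if child: "(P, L) \<in> child_rel H" for P L
  proof -
    obtain Y Z where "node_key s P = Some Y" "key L = Y @ Const (slot L) # Z"
      using node_key[of L] child_nodes[OF child] child keys unfolding keys_inv_def by blast
    then show ?thesis
      by (simp add: key_def)
  qed
  \<comment> \<open>Slots are wrapped in \<open>Const\<close> to make them entries of keys, as
    \<open>prefix_key_imp_ancestor\<close> expects.\<close>
  have slot_inj: "L = L'" if "(P, L) \<in> child_rel H" "(P, L') \<in> child_rel H"
    "Const (slot L) = Const (slot L')" for P L L'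
  proof -
    have "L \<in> active s" "L' \<in> active s"
      using child_nodes that(1,2) dom_node by (auto simp: active_def)
    then show ?thesis
      using slot_eq_siblings[OF slots that(1,2)] that(3) by blast
  qed
  show "\<forall>B \<in> concepts H. concept_key s B \<noteq> None"
    using all by blast
  show "\<forall>B1 \<in> concepts H. \<forall>B2 \<in> concepts H. B1 \<noteq> B2 \<longrightarrow>
      inst (the (concept_key s B1)) \<inter> inst (the (concept_key s B2)) = {}"
  proof (intro ballI impI)
    fix B1 B2
    assume B: "B1 \<in> concepts H" "B2 \<in> concepts H" "B1 \<noteq> B2"
    then obtain X1 X2 where "concept_key s B1 = Some X1" "concept_key s B2 = Some X2"
      using all by blast
    then show "inst (the (concept_key s B1)) \<inter> inst (the (concept_key s B2)) = {}"
      using keys B(3) by (simp add: keys_inv_def)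
  qed
  show "\<forall>B \<in> concepts H. \<forall>XB m K. concept_key s B = Some XB \<and> m = length XB \<and>
      K \<in> nodes H \<and> concept_of H K = B \<longrightarrow>
    (\<exists>XK. node_key s K = Some XK \<and>
      XK \<in> inst XB \<and>
      (\<forall>Ks. is_path H (Ks @ [K]) \<and> hd (Ks @ [K]) = root_node H \<longrightarrow>
        (K = root_node H \<or> (\<exists>i \<in> {1..m}. node_key s (last Ks) = Some (take i XK))) \<and>
        (\<forall>j \<in> {1..m}. \<forall>L \<in> nodes H - set (Ks @ [K]).
          node_key s L \<noteq> Some (take j XK))))"
  proof (intro ballI allI impI; elim conjE)
    fix B XB m K
    assume B: "concept_key s B = Some XB" "m = length XB" "K \<in> nodes H" "concept_of H K = B"
    have K: "key K \<in> inst XB"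
      using keys node_key[OF B(3)] B(1,4) unfolding keys_inv_def by (metis option.sel)
    have b: "\<exists>i \<in> {1..m}. node_key s (last Ks) = Some (take i (key K))"
      if "is_path H (Ks @ [K])" "hd (Ks @ [K]) = root_node H" "K \<noteq> root_node H" for Ks
    proof -
      let ?P = "last Ks"
      have "Ks \<noteq> []"
        using that(2,3) by auto
      then have P: "(?P, K) \<in> child_rel H"
        using path_last_child that(1) by blast
      then obtain Z where Z: "key K = key ?P @ Const (slot K) # Z"
        using key_child by blast
      have "node_key s ?P = Some (key ?P)"
        using node_key child_nodes[OF P] by blast
      moreover from this have "key ?P \<noteq> []"
        using keys by (auto simp: keys_inv_def)
      moreover have "length (key ?P) \<le> m"
        using length_inst[OF K] Z B(2) by simp
      moreover have "take (length (key ?P)) (key K) = key ?P"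
        using Z by simp
      \<comment> \<open>The witness \<open>i\<close> is the length of the parent's key, positive
        since that key is nonempty.\<close>
      ultimately show ?thesis
        by (intro bexI[of _ "length (key ?P)"]) (auto simp: Suc_le_eq)
    qed
    have c: "node_key s L \<noteq> Some (take j (key K))"
      if "is_path H (Ks @ [K])" "hd (Ks @ [K]) = root_node H" "L \<in> nodes H - set (Ks @ [K])"
      for Ks L j
    proof
      assume "node_key s L = Some (take j (key K))"
      \<comment> \<open>A node keyed by an initial key of \<open>key K\<close> is an ancestor of
        \<open>K\<close> and hence lies on the path.\<close>
      then have "prefix (key L) (key K)"
        using take_is_prefix by (simp add: key_def)
      then have "(L, K) \<in> (child_rel H)\<^sup>*"
        using B(3) that(3) key_child slot_inj
        by (intro prefix_key_imp_ancestor[where key = key and slot = "\<lambda>L. Const (slot L)"]) blast+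
      then show False
        using ancestor_on_path that by blast
    qed
    show "\<exists>XK. node_key s K = Some XK \<and> XK \<in> inst XB \<and>
      (\<forall>Ks. is_path H (Ks @ [K]) \<and> hd (Ks @ [K]) = root_node H \<longrightarrow>
        (K = root_node H \<or> (\<exists>i \<in> {1..m}. node_key s (last Ks) = Some (take i XK))) \<and>
        (\<forall>j \<in> {1..m}. \<forall>L \<in> nodes H - set (Ks @ [K]).
          node_key s L \<noteq> Some (take j XK)))"
      using node_key[OF B(3)] K b c by blast
  qed
qed

end

text \<open>Without infinite runs, every run can be continued to a state with no successor, and the
  second conjunct describes all such states.\<close>

theorem proposition2:
  fixes H :: "('n, 'c) hierarchy"
  assumes "concept_hierarchy H"
  shows "(\<nexists>run. run 0 = init_state H \<and> (\<forall>t::nat. index_step H (run t) (run (Suc t)))) \<and>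
    (\<forall>s. final_state H s \<longrightarrow>
      (\<forall>B \<in> concepts H. concept_key s B \<noteq> None) \<and>
      (\<forall>B1 \<in> concepts H. \<forall>B2 \<in> concepts H. B1 \<noteq> B2 \<longrightarrow>
        inst (the (concept_key s B1)) \<inter> inst (the (concept_key s B2)) = {}) \<and>
      (\<forall>B \<in> concepts H. \<forall>XB m K. concept_key s B = Some XB \<and> m = length XB \<and>
          K \<in> nodes H \<and> concept_of H K = B \<longrightarrow>
        (\<exists>XK. node_key s K = Some XK \<and>
          XK \<in> inst XB \<and>
          (\<forall>Ks. is_path H (Ks @ [K]) \<and> hd (Ks @ [K]) = root_node H \<longrightarrow>
            (K = root_node H \<or> (\<exists>i \<in> {1..m}. node_key s (last Ks) = Some (take i XK))) \<and>
            (\<forall>j \<in> {1..m}. \<forall>L \<in> nodes H - set (Ks @ [K]).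
              node_key s L \<noteq> Some (take j XK))))))"
  using concept_hierarchy.no_infinite_run[OF assms] concept_hierarchy.final_correct[OF assms]
  by blast

end
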